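(* Let $1\le r\le s$ be integers, let $G=GL_r(\mathbb{C})\times GL_s(\mathbb{C})$, and let $$H=\left\{(A,B)\in G : B=\begin{pmatrix} A & 0\\ 0 & D\end{pmatrix},\ D\in GL_{s-r}(\mathbb{C})\right\}.$$ Let $\mathfrak{g}$ and $\mathfrak{h}$ be the Lie algebras of $G$ and $H$, let $\mathbb{T}\subset G$ be the maximal torus of pairs of diagonal matrices, and let $\mathbb{T}_H=\mathbb{T}\cap N_G(H)$, where $N_G(H)$ is the normaliser of $H$ in $G$. Then the weight of the canonical differential $K_{G/H}$ is $1$; that is, $\mathbb{T}_H$ acts by the trivial character on the one-dimensional space $\bigwedge^{\dim G/H}(\mathfrak{g}/\mathfrak{h})^{\vee}$, where the action is induced by the adjoint action of $\mathbb{T}_H$ on $\mathfrak{g}/\mathfrak{h}$.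
   Context: The group $G$ acts on pairs of matrices $(X,Y)$, with $X$ of size $r\times s$ and $Y$ of size $s\times r$, by $(A,B)\cdot(X,Y)=(AXB^{-1},BYA^{-1})$. The subgroup $H$ is the stabiliser of $v=(X_0,Y_0)$, where $X_0=\begin{pmatrix} I_{r\times r} & 0\end{pmatrix}$ and $Y_0=\begin{pmatrix} I_{r\times r}\\ 0\end{pmatrix}$, and $G/H$ is identified with the generalised affine Stiefel variety $GSV(r,s)=\{(X,Y): XY=I_{r\times r}\}$, which has dimension $rs+r(s-r)$. The tangent space to $G/H$ at the identity coset is $\mathfrak{g}/\mathfrak{h}$, and the canonical class is $K_{G/H}=\mathrm{divisor}\left(\bigwedge^{\dim G/H}T^{\vee}_{G/H}\right)$. The weight of the canonical differential is the character by which $\mathbb{T}_H$ acts on the top exterior power of the cotangent space at the identity coset; up to inversion it is the product, with multiplicity, of the weights of $\mathfrak{g}$ that are not weights of $\mathfrak{h}$, i.e. of the weights of $\mathfrak{g}/\mathfrak{h}$. Weights are written multiplicatively, so weight $1$ means the trivial character. *)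

theory Defs
  imports
    "HOL-Analysis.Complex_Analysis_Basics"
    "HOL-Algebra.AbelCoset"
    "HOL-Algebra.Group_Action"
    "Jordan_Normal_Form.VS_Connect"
begin

definition GL :: "nat \<Rightarrow> complex mat monoid" where
  "GL n = units_of (ring_mat TYPE(complex) n ())"

definition grpG :: "nat \<Rightarrow> nat \<Rightarrow> (complex mat \<times> complex mat) monoid" where
  "grpG r s = GL r \<times>\<times> GL s"

definition grpH :: "nat \<Rightarrow> nat \<Rightarrow> (complex mat \<times> complex mat) set" where
  "grpH r s = {(A, B) \<in> carrier (grpG r s).
     \<exists>D \<in> carrier (GL (s - r)).
       B = four_block_mat A (0\<^sub>m r (s - r)) (0\<^sub>m (s - r) r) D}"

definition torus :: "nat \<Rightarrow> nat \<Rightarrow> (complex mat \<times> complex mat) set" where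
  "torus r s = {(A, B) \<in> carrier (grpG r s). diagonal_mat A \<and> diagonal_mat B}"

definition torusH :: "nat \<Rightarrow> nat \<Rightarrow> (complex mat \<times> complex mat) set" where
  "torusH r s = torus r s \<inter> normalizer (grpG r s) (grpH r s)"

definition mat_pairs :: "nat \<Rightarrow> nat \<Rightarrow> (complex, complex mat \<times> complex mat) module" where
  "mat_pairs r s =
     direct_sum (module_mat TYPE(complex) r r) (module_mat TYPE(complex) s s)"

text \<open>The Lie algebra of a closed complex subgroup \<open>K\<close> of \<open>GL r \<times> GL s\<close> is the tangent
  space of \<open>K\<close> at the identity, i.e. the set of velocities \<open>\<gamma>'(0)\<close> of germs of holomorphic
  curves \<open>\<gamma>\<close> in \<open>K\<close> with \<open>\<gamma>(0) = 1\<close>.  Holomorphy and derivatives are taken entrywise.\<close>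

definition has_velocity ::
  "nat \<Rightarrow> real \<Rightarrow> (complex \<Rightarrow> complex mat) \<Rightarrow> complex mat \<Rightarrow> bool" where
  "has_velocity n e \<gamma> X \<longleftrightarrow>
     (\<forall>i<n. \<forall>j<n. (\<lambda>z. \<gamma> z $$ (i, j)) holomorphic_on ball 0 e \<and>
                  ((\<lambda>z. \<gamma> z $$ (i, j)) has_field_derivative X $$ (i, j)) (at 0))"

definition lie_alg ::
  "nat \<Rightarrow> nat \<Rightarrow> (complex mat \<times> complex mat) set \<Rightarrow> (complex mat \<times> complex mat) set" where
  "lie_alg r s K = {(X, Y) \<in> carrier (mat_pairs r s).
     \<exists>e > 0. \<exists>\<gamma>. \<gamma> 0 = \<one>\<^bsub>grpG r s\<^esub> \<and> (\<forall>z \<in> ball 0 e. \<gamma> z \<in> K) \<and>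
       has_velocity r e (\<lambda>z. fst (\<gamma> z)) X \<and> has_velocity s e (\<lambda>z. snd (\<gamma> z)) Y}"

text \<open>The quotient \<open>V/W\<close> of a vector space by a subspace, with cosets of \<open>W\<close> as elements.
  Adding \<open>W\<close> in the scalar multiplication makes \<open>0 \<cdot> C = W\<close>.  The fields \<open>mult\<close> and \<open>one\<close>,
  which a module record also has, are immaterial.\<close>

definition quotient_space :: "('a, 'v, 'm) module_scheme \<Rightarrow> 'v set \<Rightarrow> ('a, 'v set) module" where
  "quotient_space V W =
     \<lparr>carrier = a_rcosets\<^bsub>V\<^esub> W,
      mult = (\<lambda>_ _. W),
      one = W,
      zero = W,
      add = (\<lambda>C D. C <+>\<^bsub>V\<^esub> D),
      smult = (\<lambda>c C. W <+>\<^bsub>V\<^esub> (\<lambda>x. c \<odot>\<^bsub>V\<^esub> x) ` C)\<rparr>"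

definition tangent_GH :: "nat \<Rightarrow> nat \<Rightarrow> (complex, (complex mat \<times> complex mat) set) module" where
  "tangent_GH r s =
     quotient_space ((mat_pairs r s)\<lparr>carrier := lie_alg r s (carrier (grpG r s))\<rparr>)
                    (lie_alg r s (grpH r s))"

definition dim_GH :: "nat \<Rightarrow> nat \<Rightarrow> nat" where
  "dim_GH r s = vectorspace.dim class_ring (tangent_GH r s)"

text \<open>The exterior power \<open>\<And>\<^sup>n V\<^sup>\<or>\<close> of the dual of a finite-dimensional complex vector space,
  as the space of alternating \<open>n\<close>-linear forms on \<open>V\<close>:
  \<open>\<phi>\<^sub>1 \<and> \<dots> \<and> \<phi>\<^sub>n\<close> is the form \<open>(v\<^sub>1, \<dots>, v\<^sub>n) \<mapsto> det (\<phi>\<^sub>i v\<^sub>j)\<close>.  Tuples of vectors are extensional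
  functions on \<open>{..<n}\<close>, and forms are extensional functions on tuples.\<close>

definition tuples :: "nat \<Rightarrow> (complex, 'v, 'm) module_scheme \<Rightarrow> (nat \<Rightarrow> 'v) set" where
  "tuples n V = ({..<n} \<rightarrow>\<^sub>E carrier V)"

definition multilinear ::
  "nat \<Rightarrow> (complex, 'v, 'm) module_scheme \<Rightarrow> ((nat \<Rightarrow> 'v) \<Rightarrow> complex) \<Rightarrow> bool" where
  "multilinear n V \<omega> \<longleftrightarrow>
     (\<forall>v \<in> tuples n V. \<forall>i<n.
        (\<forall>x \<in> carrier V. \<forall>y \<in> carrier V.
           \<omega> (v(i := x \<oplus>\<^bsub>V\<^esub> y)) = \<omega> (v(i := x)) + \<omega> (v(i := y))) \<and>
        (\<forall>c. \<forall>x \<in> carrier V. \<omega> (v(i := c \<odot>\<^bsub>V\<^esub> x)) = c * \<omega> (v(i := x))))"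

definition alternating ::
  "nat \<Rightarrow> (complex, 'v, 'm) module_scheme \<Rightarrow> ((nat \<Rightarrow> 'v) \<Rightarrow> complex) \<Rightarrow> bool" where
  "alternating n V \<omega> \<longleftrightarrow>
     (\<forall>v \<in> tuples n V. \<forall>i<n. \<forall>j<n. i \<noteq> j \<and> v i = v j \<longrightarrow> \<omega> v = 0)"

definition ext_power_dual ::
  "nat \<Rightarrow> (complex, 'v, 'm) module_scheme \<Rightarrow> (complex, (nat \<Rightarrow> 'v) \<Rightarrow> complex) module" where
  "ext_power_dual n V =
     (ring.func_space class_ring (tuples n V))
       \<lparr>carrier := {\<omega> \<in> tuples n V \<rightarrow>\<^sub>E UNIV. multilinear n V \<omega> \<and> alternating n V \<omega>}\<rparr>"

definition canonical_fibre ::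
  "nat \<Rightarrow> nat \<Rightarrow> (complex, (nat \<Rightarrow> (complex mat \<times> complex mat) set) \<Rightarrow> complex) module" where
  "canonical_fibre r s = ext_power_dual (dim_GH r s) (tangent_GH r s)"

definition Ad ::
  "nat \<Rightarrow> nat \<Rightarrow> complex mat \<times> complex mat \<Rightarrow> complex mat \<times> complex mat \<Rightarrow>
   complex mat \<times> complex mat" where
  "Ad r s g X = (fst g * fst X * fst (inv\<^bsub>grpG r s\<^esub> g), snd g * snd X * snd (inv\<^bsub>grpG r s\<^esub> g))"

text \<open>If \<open>g\<close> normalises \<open>H\<close>, then \<open>Ad g\<close> preserves the Lie algebra of \<open>H\<close>, and the induced map
  on the quotient sends a coset to its image under \<open>Ad g\<close>.\<close>

definition Ad_tangent ::
  "nat \<Rightarrow> nat \<Rightarrow> complex mat \<times> complex mat \<Rightarrow> (complex mat \<times> complex mat) set \<Rightarrow>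
   (complex mat \<times> complex mat) set" where
  "Ad_tangent r s g C = Ad r s g ` C"

text \<open>The contragredient action on forms:
  \<open>(g \<cdot> \<omega>)(v\<^sub>1, \<dots>, v\<^sub>n) = \<omega>(Ad g\<^sup>-\<^sup>1 v\<^sub>1, \<dots>, Ad g\<^sup>-\<^sup>1 v\<^sub>n)\<close>.\<close>

definition canonical_action ::
  "nat \<Rightarrow> nat \<Rightarrow> complex mat \<times> complex mat \<Rightarrow>
   ((nat \<Rightarrow> (complex mat \<times> complex mat) set) \<Rightarrow> complex) \<Rightarrow>
   ((nat \<Rightarrow> (complex mat \<times> complex mat) set) \<Rightarrow> complex)" where
  "canonical_action r s g \<omega> =
     (\<lambda>v \<in> tuples (dim_GH r s) (tangent_GH r s).
        \<omega> (\<lambda>i \<in> {..<dim_GH r s}. Ad_tangent r s (inv\<^bsub>grpG r s\<^esub> g) (v i)))"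

definition acts_by_character ::
  "'g set \<Rightarrow> ('g \<Rightarrow> 'v \<Rightarrow> 'v) \<Rightarrow> (complex, 'v, 'm) module_scheme \<Rightarrow> ('g \<Rightarrow> complex) \<Rightarrow> bool" where
  "acts_by_character T act V wt \<longleftrightarrow> (\<forall>t \<in> T. \<forall>v \<in> carrier V. act t v = wt t \<odot>\<^bsub>V\<^esub> v)"

end

theory Submission
  imports Defs
begin

text \<open>The entries of \<open>Y - diag(X, 0)\<close> outside the lower right block are linear coordinates on
  \<open>\<gg>/\<hh>\<close>.  An element \<open>t = (diag a, diag b)\<close> of \<open>T\<^sub>H\<close> satisfies \<open>a\<^sub>i / a\<^sub>j = b\<^sub>i / b\<^sub>j\<close> for
  \<open>i, j < r\<close>, so \<open>t\<^sup>-\<^sup>1\<close> acts diagonally in these coordinates, with weight \<open>b\<^sub>j / b\<^sub>i\<close> at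
  \<open>(i, j)\<close>.  The index set is symmetric, so the product of all weights is 1.  An alternating form of
  top degree is determined by its value on a basis, and hence is multiplied by the product of the
  weights, i.e. is fixed.\<close>

section \<open>Alternating forms of top degree\<close>

text \<open>Lie algebras are given as velocities of holomorphic curves and the quotient as a set of
  cosets, so the coordinates have to be justified. Inside G, the subgroup H is cut out by
  homogeneous linear equations that hold at the identity. Differentiating them along a curve in H
  gives one inclusion for its Lie algebra; for the other, straight lines \<open>1 + z X\<close>
  replace the exponential map. The coordinates form a surjection from all pairs of matrices onto C^n
  whose kernel is this Lie algebra, so every coset is a fibre and the torus is followed on whole
  fibres, without representatives. The group \<open>torusH\<close> is never determined. Of
  normalisation only the ratio identity is used: it makes corresponding entries of X and Y scale
  alike, so that their difference is an eigenfunction. On a zero space every character would do, so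
  the space of forms is also shown to have dimension one; a determinant in the coordinates provides
  a nonzero form.\<close>

lemma tuples_fun_upd:
  assumes "v \<in> tuples n V" "i < n" "x \<in> carrier V"
  shows "v(i := x) \<in> tuples n V"
  using assms unfolding tuples_def by (auto simp: PiE_iff extensional_def)

lemma tuples_memD: "v \<in> tuples n V \<Longrightarrow> i < n \<Longrightarrow> v i \<in> carrier V"
  unfolding tuples_def by auto

lemma tuples_comp_permutes:
  assumes "v \<in> tuples n V" "p permutes {..<n}"
  shows "v \<circ> p \<in> tuples n V"
proof (unfold tuples_def, rule PiE_I)
  fix i assume "i \<in> {..<n}"
  then show "(v \<circ> p) i \<in> carrier V"
    using assms permutes_in_image[OF assms(2)] by (auto intro: tuples_memD)
next
  fix i assume "i \<notin> {..<n}"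
  then show "(v \<circ> p) i = undefined"
    using assms permutes_not_in[OF assms(2)] by (auto simp: tuples_def PiE_iff extensional_def)
qed

lemma multilinear_add:
  assumes "multilinear n V \<omega>" "v \<in> tuples n V" "i < n" "x \<in> carrier V" "y \<in> carrier V"
  shows "\<omega> (v(i := x \<oplus>\<^bsub>V\<^esub> y)) = \<omega> (v(i := x)) + \<omega> (v(i := y))"
  using assms unfolding multilinear_def by blast

lemma multilinear_smult:
  assumes "multilinear n V \<omega>" "v \<in> tuples n V" "i < n" "x \<in> carrier V"
  shows "\<omega> (v(i := c \<odot>\<^bsub>V\<^esub> x)) = c * \<omega> (v(i := x))"
  using assms unfolding multilinear_def by blast

lemma alternatingD:
  assumes "alternating n V \<omega>" "v \<in> tuples n V" "i < n" "j < n" "i \<noteq> j" "v i = v j"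
  shows "\<omega> v = 0"
  using assms unfolding alternating_def by blast

text \<open>Expand the value 0 at a tuple with x + y in both slots: the terms with x twice or y
  twice vanish, so the two mixed terms cancel.\<close>

lemma alternating_transpose:
  assumes V: "module class_ring V"
    and \<omega>: "multilinear n V \<omega>" "alternating n V \<omega>"
    and v: "v \<in> tuples n V" and ij: "i < n" "j < n" "i \<noteq> j"
  shows "\<omega> (v \<circ> Transposition.transpose i j) = - \<omega> v"
proof -
  interpret module "class_ring :: complex ring" V by fact
  define f where "f x y = \<omega> (v(i := x, j := y))" for x y
  let ?x = "v i" and ?y = "v j"
  have x: "?x \<in> carrier V" and y: "?y \<in> carrier V" using v ij by (auto intro: tuples_memD)
  have add_right: "f u (w \<oplus>\<^bsub>V\<^esub> w') = f u w + f u w'"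
    if "u \<in> carrier V" "w \<in> carrier V" "w' \<in> carrier V" for u w w'
    unfolding f_def using that v ij by (intro multilinear_add[OF \<omega>(1)] tuples_fun_upd) auto
  have add_left: "f (w \<oplus>\<^bsub>V\<^esub> w') u = f w u + f w' u"
    if "u \<in> carrier V" "w \<in> carrier V" "w' \<in> carrier V" for u w w'
    \<comment> \<open>Reordering the updates puts slot \<open>i\<close> last, where additivity in
      one slot applies.\<close>
    unfolding f_def fun_upd_twist[OF ij(3)]
    using that v ij by (intro multilinear_add[OF \<omega>(1)] tuples_fun_upd) auto
  have zero: "f u u = 0" if "u \<in> carrier V" for u
    unfolding f_def using that v ij
    by (intro alternatingD[OF \<omega>(2), of _ i j] tuples_fun_upd) auto
  have "f (?x \<oplus>\<^bsub>V\<^esub> ?y) (?x \<oplus>\<^bsub>V\<^esub> ?y) = f ?x ?x + f ?x ?y + (f ?y ?x + f ?y ?y)"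
    using x y by (simp add: add_left add_right)
  then have "f ?y ?x = - f ?x ?y"
    using x y by (simp add: zero eq_neg_iff_add_eq_0 add.commute)
  moreover have "v(i := ?x, j := ?y) = v" by simp
  moreover have "v(i := ?y, j := ?x) = v \<circ> Transposition.transpose i j"
    using ij by (auto simp: fun_eq_iff transpose_def)
  ultimately show ?thesis unfolding f_def by simp
qed

text \<open>Only vanishing is tracked, which avoids the sign of the permutation. The induction over
  transpositions lets the tuple vary, because each transposition is absorbed into it.\<close>

lemma alternating_permutes_eq_0:
  assumes V: "module class_ring V"
    and \<omega>: "multilinear n V \<omega>" "alternating n V \<omega>"
    and p: "p permutes {..<n}" and v: "v \<in> tuples n V" "\<omega> v = 0"
  shows "\<omega> (v \<circ> p) = 0"
  using p finite_lessThan v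
proof (induction arbitrary: v rule: permutes_induct)
  case id
  then show ?case by simp
next
  case (swap a b p)
  have "v \<circ> Transposition.transpose a b \<in> tuples n V"
    using swap.hyps swap.prems by (intro tuples_comp_permutes permutes_swap_id) auto
  moreover have "\<omega> (v \<circ> Transposition.transpose a b) = 0"
    using alternating_transpose[OF V \<omega> swap.prems(1), of a b] swap.hyps swap.prems by simp
  ultimately have "\<omega> (v \<circ> Transposition.transpose a b \<circ> p) = 0"
    by (rule swap.IH)
  then show ?case by (simp only: comp_assoc)
qed

text \<open>Arguments are replaced by vectors of \<open>e\<close> one slot at a time. What remains
  is a tuple of vectors of \<open>e\<close>: either one is repeated, or the tuple is a permutation
  of \<open>e\<close>.\<close>

lemma top_form_eq_0:
  assumes V: "module class_ring V" and e: "e \<in> tuples n V"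
    and span: "LinearCombinations.module.span class_ring V (e ` {..<n}) = carrier V"
    and \<omega>: "multilinear n V \<omega>" "alternating n V \<omega>" and e0: "\<omega> e = 0"
    and v: "v \<in> tuples n V"
  shows "\<omega> v = 0"
proof -
  interpret module "class_ring :: complex ring" V by fact
  \<comment> \<open>Slots below \<open>k\<close> are arbitrary, all later ones hold vectors of
    \<open>e\<close>; the case \<open>k = n\<close> is the goal.\<close>
  have "\<omega> v = 0" if "k \<le> n" "v \<in> tuples n V" "\<And>i. k \<le> i \<Longrightarrow> i < n \<Longrightarrow> v i \<in> e ` {..<n}" for k v
    using that
  proof (induction k arbitrary: v)
    case 0
    then have "\<forall>i\<in>{..<n}. \<exists>j<n. v i = e j" by auto
    then obtain f where f: "f i < n" "v i = e (f i)" if "i < n" for i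
      by (metis lessThan_iff)
    show ?case
    proof (cases "inj_on f {..<n}")
      case True
      \<comment> \<open>The identity outside the index range is what \<open>permutes\<close>
        demands.\<close>
      define p where "p i = (if i < n then f i else i)" for i
      have "inj_on p {..<n}" using True by (simp add: p_def inj_on_def)
      then have "bij_betw p {..<n} {..<n}"
        using f by (intro bij_betw_imageI endo_inj_surj) (auto simp: p_def)
      then have p: "p permutes {..<n}" by (rule bij_imp_permutes) (simp add: p_def)
      have "v = e \<circ> p"
        using f e 0 by (auto simp: fun_eq_iff p_def tuples_def PiE_iff extensional_def)
      then show ?thesis using alternating_permutes_eq_0[OF V \<omega> p e e0] by simp
    next
      case False
      then obtain i j where "i < n" "j < n" "i \<noteq> j" "f i = f j" by (auto simp: inj_on_def)
      then show ?thesis using f 0 by (intro alternatingD[OF \<omega>(2), of v i j]) auto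
    qed
  next
    case (Suc k)
    \<comment> \<open>The form is linear in slot \<open>k\<close>, so the vectors that annihilate it
      there form a submodule. It contains \<open>e\<close> by the induction hypothesis, hence also
      the span of \<open>e\<close>.\<close>
    let ?N = "{x \<in> carrier V. \<omega> (v(k := x)) = 0}"
    have k: "k < n" using Suc by simp
    have "submodule class_ring ?N V"
    proof
      have "\<omega> (v(k := 0 \<odot>\<^bsub>V\<^esub> \<zero>\<^bsub>V\<^esub>)) = 0"
        using multilinear_smult[OF \<omega>(1) Suc.prems(2) k, of "\<zero>\<^bsub>V\<^esub>" 0] by simp
      then show "\<zero>\<^bsub>V\<^esub> \<in> ?N" using rmult_0[of 0] by simp
    qed (use multilinear_add[OF \<omega>(1) Suc.prems(2) k] multilinear_smult[OF \<omega>(1) Suc.prems(2) k]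
          in \<open>auto simp: V\<close>)
    moreover have "e ` {..<n} \<subseteq> ?N"
    proof
      fix x assume x: "x \<in> e ` {..<n}"
      then have "x \<in> carrier V" using e by (auto intro: tuples_memD)
      moreover from this have "\<omega> (v(k := x)) = 0"
        using Suc.prems x k by (intro Suc.IH tuples_fun_upd) auto
      ultimately show "x \<in> ?N" by simp
    qed
    ultimately have "carrier V \<subseteq> ?N" using span_is_subset span by metis
    then have "v k \<in> ?N" using Suc.prems k by (auto intro: tuples_memD)
    then show ?case by simp
  qed
  from this[of n v] v show ?thesis by simp
qed

section \<open>The vector space of alternating forms\<close>

lemma ext_power_dual_simps:
  "carrier (ext_power_dual n V) = {\<omega> \<in> tuples n V \<rightarrow>\<^sub>E UNIV. multilinear n V \<omega> \<and> alternating n V \<omega>}"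
  "zero (ext_power_dual n V) = (\<lambda>v\<in>tuples n V. 0)"
  "add (ext_power_dual n V) = (\<lambda>f g. \<lambda>v\<in>tuples n V. f v + g v)"
  "smult (ext_power_dual n V) = (\<lambda>c f. \<lambda>v\<in>tuples n V. c * f v)"
  unfolding ext_power_dual_def class_ring.func_space_def by simp_all

text \<open>The module operations stay in the carrier, so the condition evaluates the form at tuples
  only. Forms can thus be written as plain functions and made extensional afterwards.\<close>

lemma multilinear_restrict:
  assumes "module class_ring V"
  shows "multilinear n V (restrict \<omega> (tuples n V)) \<longleftrightarrow> multilinear n V \<omega>"
proof -
  interpret module "class_ring :: complex ring" V by fact
  show ?thesis
    unfolding multilinear_def by (simp add: tuples_fun_upd smult_closed)
qed

lemma alternating_restrict:
  "alternating n V (restrict \<omega> (tuples n V)) \<longleftrightarrow> alternating n V \<omega>"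
  unfolding alternating_def by simp

lemma multilinear_lincomb:
  assumes "multilinear n V \<omega>" "multilinear n V \<eta>"
  shows "multilinear n V (\<lambda>v. a * \<omega> v + b * \<eta> v)"
  using assms unfolding multilinear_def by (simp add: algebra_simps)

lemma alternating_lincomb:
  assumes "alternating n V \<omega>" "alternating n V \<eta>"
  shows "alternating n V (\<lambda>v. a * \<omega> v + b * \<eta> v)"
  using assms unfolding alternating_def by simp

text \<open>The difference of \<eta> and a times \<omega> is an alternating form that vanishes on
  \<open>e\<close>.\<close>

lemma top_form_proportional:
  assumes V: "module class_ring V" and e: "e \<in> tuples n V"
    and span: "LinearCombinations.module.span class_ring V (e ` {..<n}) = carrier V"
    and \<omega>: "multilinear n V \<omega>" "alternating n V \<omega>"
    and \<eta>: "multilinear n V \<eta>" "alternating n V \<eta>"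
    and eq: "\<eta> e = a * \<omega> e" and v: "v \<in> tuples n V"
  shows "\<eta> v = a * \<omega> v"
proof -
  have "1 * \<eta> v + (- a) * \<omega> v = 0"
    by (rule top_form_eq_0[OF V e span multilinear_lincomb[OF \<eta>(1) \<omega>(1), of 1 "- a"]
          alternating_lincomb[OF \<eta>(2) \<omega>(2), of 1 "- a"] _ v]) (simp add: eq)
  then show ?thesis by simp
qed

lemma vectorspace_ext_power_dual:
  assumes V: "module class_ring V"
  shows "vectorspace class_ring (ext_power_dual n V)"
proof -
  let ?L = "ext_power_dual n V"
  \<comment> \<open>Closure under sums, scalar multiples and negatives are all instances of this for
    suitable \<open>a\<close> and \<open>b\<close>.\<close>
  have lincomb: "(\<lambda>v\<in>tuples n V. a * \<omega> v + b * \<eta> v) \<in> carrier ?L"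
    if "\<omega> \<in> carrier ?L" "\<eta> \<in> carrier ?L" for \<omega> \<eta> a b
    using that
    by (simp add: ext_power_dual_simps multilinear_restrict[OF V] alternating_restrict
        multilinear_lincomb alternating_lincomb)
  have zero: "\<zero>\<^bsub>?L\<^esub> \<in> carrier ?L"
    by (simp add: ext_power_dual_simps multilinear_restrict[OF V] alternating_restrict)
       (simp add: multilinear_def alternating_def)
  have ext: "\<omega> \<in> extensional (tuples n V)" if "\<omega> \<in> carrier ?L" for \<omega>
    using that by (auto simp: ext_power_dual_simps PiE_def)
  show ?thesis
  proof (rule vs_criteria)
    show "field (class_ring :: complex ring)" by (rule class_field)
    show "\<forall>\<omega>\<in>carrier ?L. \<exists>\<eta>\<in>carrier ?L. \<omega> \<oplus>\<^bsub>?L\<^esub> \<eta> = \<zero>\<^bsub>?L\<^esub>"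
    proof
      fix \<omega> assume "\<omega> \<in> carrier ?L"
      from lincomb[OF this this, of "-1" 0]
      have "(\<lambda>v\<in>tuples n V. - \<omega> v) \<in> carrier ?L" by simp
      moreover have "\<omega> \<oplus>\<^bsub>?L\<^esub> (\<lambda>v\<in>tuples n V. - \<omega> v) = \<zero>\<^bsub>?L\<^esub>"
        by (auto simp: ext_power_dual_simps)
      ultimately show "\<exists>\<eta>\<in>carrier ?L. \<omega> \<oplus>\<^bsub>?L\<^esub> \<eta> = \<zero>\<^bsub>?L\<^esub>" by blast
    qed
    show "\<forall>\<omega> \<eta>. \<omega> \<in> carrier ?L \<and> \<eta> \<in> carrier ?L \<longrightarrow> \<omega> \<oplus>\<^bsub>?L\<^esub> \<eta> \<in> carrier ?L"
      using lincomb[of _ _ 1 1] by (simp add: ext_power_dual_simps)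
    show "\<forall>c \<omega>. c \<in> carrier class_ring \<and> \<omega> \<in> carrier ?L \<longrightarrow> c \<odot>\<^bsub>?L\<^esub> \<omega> \<in> carrier ?L"
      using lincomb[of _ _ _ 0] by (simp add: ext_power_dual_simps)
  qed (use zero ext in \<open>auto simp: ext_power_dual_simps algebra_simps
        intro!: extensionalityI[of _ "tuples n V"]\<close>)
qed

text \<open>With \<open>c\<close> a coordinate map, this is the volume form of the coordinates; it
  later serves as a nonzero form of top degree.\<close>

lemma det_form:
  assumes "linear_map class_ring V (module_vec TYPE(complex) n) c"
  shows "multilinear n V (\<lambda>v. det (mat\<^sub>r n n (\<lambda>i. c (v i))))"
    and "alternating n V (\<lambda>v. det (mat\<^sub>r n n (\<lambda>i. c (v i))))"
proof -
  interpret linear_map "class_ring :: complex ring" V "module_vec TYPE(complex) n" c by fact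
  have c_carrier: "c x \<in> carrier_vec n" if "x \<in> carrier V" for x
    using T_im[OF that] by (simp add: module_vec_simps)
  have c_tuple: "(\<lambda>i. c (v i)) \<in> {0..<n} \<rightarrow> carrier_vec n" if "v \<in> tuples n V" for v
    using that by (auto intro!: c_carrier tuples_memD)
  have upd: "(\<lambda>i. c ((v(k := x)) i)) = (\<lambda>i. if i = k then c x else c (v i))" for v k x
    by auto
  show "multilinear n V (\<lambda>v. det (mat\<^sub>r n n (\<lambda>i. c (v i))))"
    unfolding multilinear_def upd
  proof (intro ballI allI impI conjI)
    fix v k x y assume v: "v \<in> tuples n V" and k: "k < n"
      and x: "x \<in> carrier V" and y: "y \<in> carrier V"
    have c_add: "c (x \<oplus>\<^bsub>V\<^esub> y) = c x + c y"
      using T_add[OF x y] by (simp add: module_vec_simps)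
    show "det (mat\<^sub>r n n (\<lambda>i. if i = k then c (x \<oplus>\<^bsub>V\<^esub> y) else c (v i)))
      = det (mat\<^sub>r n n (\<lambda>i. if i = k then c x else c (v i)))
        + det (mat\<^sub>r n n (\<lambda>i. if i = k then c y else c (v i)))"
      unfolding c_add
      by (rule det_row_add[where a="\<lambda>_. c x" and b="\<lambda>_. c y", OF _ _ c_tuple[OF v] k])
         (use x y in \<open>simp_all add: c_carrier\<close>)
  next
    fix v k a x assume v: "v \<in> tuples n V" and k: "k < n" and x: "x \<in> carrier V"
    let ?w = "\<lambda>i. if i = k then c x else c (v i)"
    have "c (a \<odot>\<^bsub>V\<^esub> x) = a \<cdot>\<^sub>v c x" using T_smult[OF _ x, of a] by (simp add: module_vec_simps)
    \<comment> \<open>\<open>det_rows_mul\<close> scales all rows at once, so every row other than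
      \<open>k\<close> receives the factor 1.\<close>
    then have "mat\<^sub>r n n (\<lambda>i. if i = k then c (a \<odot>\<^bsub>V\<^esub> x) else c (v i))
      = mat\<^sub>r n n (\<lambda>i. (if i = k then a else 1) \<cdot>\<^sub>v ?w i)"
      by (intro arg_cong[of _ _ "\<lambda>f. mat\<^sub>r n n f"]) auto
    also have "det \<dots> = prod (\<lambda>i. if i = k then a else 1) {0..<n} * det (mat\<^sub>r n n ?w)"
      using c_tuple[OF v] c_carrier[OF x] by (intro det_rows_mul) auto
    finally show "det (mat\<^sub>r n n (\<lambda>i. if i = k then c (a \<odot>\<^bsub>V\<^esub> x) else c (v i)))
      = a * det (mat\<^sub>r n n ?w)"
      using k by (simp add: prod.delta)
  qed
  show "alternating n V (\<lambda>v. det (mat\<^sub>r n n (\<lambda>i. c (v i))))"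
    unfolding alternating_def
  proof (intro ballI allI impI, elim conjE)
    fix v i j assume v: "v \<in> tuples n V" and ij: "i < n" "j < n" "i \<noteq> j" "v i = v j"
    show "det (mat\<^sub>r n n (\<lambda>i. c (v i))) = 0"
      by (rule det_identical_rows[OF _ ij(3,1,2)])
         (use ij c_tuple[OF v] in \<open>auto intro!: eq_vecI\<close>)
  qed
qed

lemma linear_map_inv_into:
  assumes "linear_map K W V F" and bij: "bij_betw F (carrier W) (carrier V)"
  shows "linear_map K V W (inv_into (carrier W) F)"
proof -
  interpret linear_map K W V F by fact
  let ?G = "inv_into (carrier W) F"
  have G: "?G x \<in> carrier W" "F (?G x) = x" if "x \<in> carrier V" for x
    using that bij by (auto simp: bij_betw_def inv_into_into f_inv_into_f)
  have GF: "?G (F w) = w" if "w \<in> carrier W" for w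
    using that bij by (auto simp: bij_betw_def)
  have "?G (x \<oplus>\<^bsub>V\<^esub> y) = ?G x \<oplus>\<^bsub>W\<^esub> ?G y" if "x \<in> carrier V" "y \<in> carrier V" for x y
    using GF[of "?G x \<oplus>\<^bsub>W\<^esub> ?G y"] G that by (simp add: T_add)
  moreover have "?G (a \<odot>\<^bsub>V\<^esub> x) = a \<odot>\<^bsub>W\<^esub> ?G x" if "a \<in> carrier K" "x \<in> carrier V" for a x
    using GF[of "a \<odot>\<^bsub>W\<^esub> ?G x"] G that by (simp add: T_smult)
  ultimately have "?G \<in> module_hom K V W"
    using G(1) by (auto simp: module_hom_def)
  then show ?thesis
    by unfold_locales
qed

section \<open>Bases transported from C^n, and forms of top degree\<close>

definition frame :: "nat \<Rightarrow> (complex vec \<Rightarrow> 'v) \<Rightarrow> nat \<Rightarrow> 'v" where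
  "frame n F = (\<lambda>k\<in>{..<n}. F (unit_vec n k))"

lemma frame_tuple:
  assumes "bij_betw F (carrier_vec n) (carrier V)"
  shows "frame n F \<in> tuples n V"
  using assms by (auto simp: frame_def tuples_def bij_betw_def)

lemma span_frame:
  assumes F: "linear_map class_ring (module_vec TYPE(complex) n) V F"
    and bij: "bij_betw F (carrier_vec n) (carrier V)"
  shows "LinearCombinations.module.span class_ring V (frame n F ` {..<n}) = carrier V"
proof -
  interpret F: linear_map "class_ring :: complex ring" "module_vec TYPE(complex) n" V F by fact
  interpret vec: vec_space "TYPE(complex)" n .
  have "F.W.basis (F ` set (unit_vecs n))"
    using bij vec.unit_vecs_basis vec.fin_dim
    by (intro F.linear_inj_image_is_basis) (auto simp: bij_betw_def module_vec_simps)
  moreover have "F ` set (unit_vecs n) = frame n F ` {..<n}"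
    by (auto simp: frame_def unit_vecs_def image_image)
  ultimately show ?thesis by (simp add: F.W.basis_def)
qed

lemma dim_frame:
  assumes F: "linear_map class_ring (module_vec TYPE(complex) n) V F"
    and bij: "bij_betw F (carrier_vec n) (carrier V)"
  shows "vectorspace.dim class_ring V = n"
proof -
  interpret F: linear_map "class_ring :: complex ring" "module_vec TYPE(complex) n" V F by fact
  interpret vec: vec_space "TYPE(complex)" n .
  show ?thesis
    using F.dim_eq bij vec.fin_dim vec.dim_is_n by (simp add: bij_betw_def module_vec_simps)
qed

text \<open>The determinant in the coordinates takes the value 1 on the frame. Any form is therefore
  its own frame value times this determinant, since both sides agree on the frame.\<close>

lemma dim_ext_power_dual_top:
  assumes F: "linear_map class_ring (module_vec TYPE(complex) n) V F"
    and bij: "bij_betw F (carrier_vec n) (carrier V)"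
  shows "vectorspace.dim class_ring (ext_power_dual n V) = 1"
proof -
  interpret F: linear_map "class_ring :: complex ring" "module_vec TYPE(complex) n" V F by fact
  have V: "module class_ring V" by unfold_locales
  let ?L = "ext_power_dual n V" and ?e = "frame n F"
  interpret L: vectorspace "class_ring :: complex ring" ?L
    by (rule vectorspace_ext_power_dual[OF V])
  define c where "c = inv_into (carrier_vec n) F"
  have c: "linear_map class_ring V (module_vec TYPE(complex) n) c"
    using linear_map_inv_into[OF F] bij by (simp add: c_def module_vec_simps)
  define \<delta> where "\<delta> = (\<lambda>v\<in>tuples n V. det (mat\<^sub>r n n (\<lambda>i. c (v i))))"
  have \<delta>: "\<delta> \<in> carrier ?L"
    unfolding \<delta>_def using det_form[OF c]
    by (simp add: ext_power_dual_simps multilinear_restrict[OF V] alternating_restrict)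
  have e: "?e \<in> tuples n V" by (rule frame_tuple[OF bij])
  have "c (?e i) = unit_vec n i" if "i < n" for i
    using that bij by (auto simp: c_def frame_def bij_betw_def)
  then have "mat\<^sub>r n n (\<lambda>i. c (?e i)) = 1\<^sub>m n"
    by (intro eq_matI) auto
  then have \<delta>e: "\<delta> ?e = 1" using e by (simp add: \<delta>_def)
  have \<omega>_eq: "\<omega> = \<omega> ?e \<odot>\<^bsub>?L\<^esub> \<delta>" if \<omega>: "\<omega> \<in> carrier ?L" for \<omega>
  proof (rule extensionalityI)
    show "\<omega> \<in> extensional (tuples n V)" using \<omega> by (auto simp: ext_power_dual_simps PiE_def)
    show "\<omega> ?e \<odot>\<^bsub>?L\<^esub> \<delta> \<in> extensional (tuples n V)" by (simp add: ext_power_dual_simps)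
    fix v assume v: "v \<in> tuples n V"
    have "\<omega> v = \<omega> ?e * \<delta> v"
      by (rule top_form_proportional[OF V e span_frame[OF F bij] _ _ _ _ _ v])
         (use \<omega> \<delta> \<delta>e in \<open>simp_all add: ext_power_dual_simps\<close>)
    then show "\<omega> v = (\<omega> ?e \<odot>\<^bsub>?L\<^esub> \<delta>) v" using v by (simp add: ext_power_dual_simps)
  qed
  show ?thesis
  proof (rule L.dim1I)
    show "\<delta> \<in> carrier ?L" by fact
    show "\<delta> \<noteq> \<zero>\<^bsub>?L\<^esub>" using \<delta>e e by (auto simp: ext_power_dual_simps)
    show "L.gen_set {\<delta>}"
    proof
      show "L.span {\<delta>} \<subseteq> carrier ?L" using L.span_closed[of "{\<delta>}"] \<delta> by blast
      show "carrier ?L \<subseteq> L.span {\<delta>}"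
      proof
        fix \<omega> assume \<omega>: "\<omega> \<in> carrier ?L"
        have "\<omega> ?e \<odot>\<^bsub>?L\<^esub> \<delta> \<in> L.span {\<delta>}"
          using L.span_is_submodule[of "{\<delta>}"] L.span_self[OF \<delta>] \<delta>
          by (intro submodule.smult_closed) auto
        then show "\<omega> \<in> L.span {\<delta>}" using \<omega>_eq[OF \<omega>] by simp
      qed
    qed
  qed
qed

text \<open>Precomposing with \<open>L\<close> in every slot gives another alternating form, so
  comparing the two on the frame suffices. There \<open>L\<close> only scales each vector, and
  multilinearity extracts the factors.\<close>

lemma top_form_diagonal:
  assumes F: "linear_map class_ring (module_vec TYPE(complex) n) V F"
    and bij: "bij_betw F (carrier_vec n) (carrier V)"
    and \<omega>: "multilinear n V \<omega>" "alternating n V \<omega>"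
    and closed: "\<And>x. x \<in> carrier V \<Longrightarrow> L x \<in> carrier V"
    and add: "\<And>x y. x \<in> carrier V \<Longrightarrow> y \<in> carrier V \<Longrightarrow> L (x \<oplus>\<^bsub>V\<^esub> y) = L x \<oplus>\<^bsub>V\<^esub> L y"
    and smult: "\<And>a x. x \<in> carrier V \<Longrightarrow> L (a \<odot>\<^bsub>V\<^esub> x) = a \<odot>\<^bsub>V\<^esub> L x"
    and diag: "\<And>k. k < n \<Longrightarrow> L (F (unit_vec n k)) = \<mu> k \<odot>\<^bsub>V\<^esub> F (unit_vec n k)"
    and v: "v \<in> tuples n V"
  shows "\<omega> (\<lambda>i\<in>{..<n}. L (v i)) = (\<Prod>k<n. \<mu> k) * \<omega> v"
proof -
  interpret F: linear_map "class_ring :: complex ring" "module_vec TYPE(complex) n" V F by fact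
  have V: "module class_ring V" by unfold_locales
  let ?e = "frame n F"
  define \<eta> where "\<eta> v = \<omega> (\<lambda>i\<in>{..<n}. L (v i))" for v
  have e: "?e \<in> tuples n V" by (rule frame_tuple[OF bij])
  have tup: "(\<lambda>i\<in>{..<n}. L (v i)) \<in> tuples n V" if "v \<in> tuples n V" for v
    using that closed by (auto simp: tuples_def)
  have upd: "(\<lambda>i\<in>{..<n}. L ((v(k := x)) i)) = (\<lambda>i\<in>{..<n}. L (v i))(k := L x)" if "k < n" for v k x
    using that by (auto simp: fun_eq_iff)
  have \<eta>_upd: "\<eta> (v(k := x)) = \<omega> ((\<lambda>i\<in>{..<n}. L (v i))(k := L x))" if "k < n" for v k x
    unfolding \<eta>_def upd[OF that] ..
  have \<eta>: "multilinear n V \<eta>" "alternating n V \<eta>"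
  proof -
    show "multilinear n V \<eta>"
      unfolding multilinear_def
      using multilinear_add[OF \<omega>(1) tup] multilinear_smult[OF \<omega>(1) tup] closed
      by (simp add: \<eta>_upd add smult del: fun_upd_apply)
    show "alternating n V \<eta>"
      unfolding alternating_def \<eta>_def
    proof (intro ballI allI impI, elim conjE)
      fix v i j assume "v \<in> tuples n V" "i < n" "j < n" "i \<noteq> j" "v i = v j"
      then show "\<omega> (\<lambda>i\<in>{..<n}. L (v i)) = 0"
        by (intro alternatingD[OF \<omega>(2) tup, of v i j]) auto
    qed
  qed
  \<comment> \<open>The first \<open>k\<close> frame vectors are scaled; each induction step
    extracts one further factor.\<close>
  have "\<omega> (\<lambda>i. if i < k then \<mu> i \<odot>\<^bsub>V\<^esub> ?e i else ?e i) = (\<Prod>i<k. \<mu> i) * \<omega> ?e" if "k \<le> n" for k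
    using that
  proof (induction k)
    case (Suc k)
    let ?w = "\<lambda>i. if i < k then \<mu> i \<odot>\<^bsub>V\<^esub> ?e i else ?e i"
    have w: "?w \<in> tuples n V"
      using e Suc by (auto simp: tuples_def PiE_iff extensional_def)
    have ek: "?e k \<in> carrier V" using e Suc by (auto intro: tuples_memD)
    have "(\<lambda>i. if i < Suc k then \<mu> i \<odot>\<^bsub>V\<^esub> ?e i else ?e i) = ?w(k := \<mu> k \<odot>\<^bsub>V\<^esub> ?e k)"
      by (auto simp: fun_eq_iff less_Suc_eq)
    moreover have "?w(k := ?e k) = ?w" by (auto simp: fun_eq_iff)
    ultimately show ?case
      using multilinear_smult[OF \<omega>(1) w _ ek, of k "\<mu> k"] Suc by (simp add: mult.assoc mult.left_commute)
  qed simp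
  from this[of n] have "\<omega> (\<lambda>i. if i < n then \<mu> i \<odot>\<^bsub>V\<^esub> ?e i else ?e i) = (\<Prod>i<n. \<mu> i) * \<omega> ?e"
    by simp
  moreover have "(\<lambda>i\<in>{..<n}. L (?e i)) = (\<lambda>i. if i < n then \<mu> i \<odot>\<^bsub>V\<^esub> ?e i else ?e i)"
    using diag by (auto simp: fun_eq_iff frame_def)
  ultimately have "\<eta> ?e = (\<Prod>k<n. \<mu> k) * \<omega> ?e" by (simp add: \<eta>_def)
  then have "\<eta> v = (\<Prod>k<n. \<mu> k) * \<omega> v"
    by (rule top_form_proportional[OF V e span_frame[OF F bij] \<omega> \<eta> _ v])
  then show ?thesis by (simp add: \<eta>_def)
qed

section \<open>Quotient spaces as images of linear maps\<close>

text \<open>The target is not assumed to be a vector space. Its elements are images under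
  \<open>F\<close>, and compatibility with the operations carries each axiom over from
  \<open>W\<close>. This spares a direct verification for coset arithmetic.\<close>

lemma linear_map_transport:
  assumes W: "vectorspace K W" and bij: "bij_betw F (carrier W) (carrier Q)"
    and add: "\<And>x y. x \<in> carrier W \<Longrightarrow> y \<in> carrier W \<Longrightarrow> F (x \<oplus>\<^bsub>W\<^esub> y) = F x \<oplus>\<^bsub>Q\<^esub> F y"
    and smult: "\<And>a x. a \<in> carrier K \<Longrightarrow> x \<in> carrier W \<Longrightarrow> F (a \<odot>\<^bsub>W\<^esub> x) = a \<odot>\<^bsub>Q\<^esub> F x"
    and zero: "F \<zero>\<^bsub>W\<^esub> = \<zero>\<^bsub>Q\<^esub>"
  shows "linear_map K W Q F"
proof -
  interpret W: vectorspace K W by fact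
  have Q: "carrier Q = F ` carrier W" using bij by (simp add: bij_betw_def)
  have "vectorspace K Q"
  proof (rule vs_criteria)
    show "field K" by unfold_locales
    show "\<forall>x\<in>carrier Q. \<exists>y\<in>carrier Q. x \<oplus>\<^bsub>Q\<^esub> y = \<zero>\<^bsub>Q\<^esub>"
    proof
      fix x assume "x \<in> carrier Q"
      then obtain w where w: "w \<in> carrier W" "x = F w" using Q by auto
      then have "x \<oplus>\<^bsub>Q\<^esub> F (\<ominus>\<^bsub>W\<^esub> w) = \<zero>\<^bsub>Q\<^esub>"
        by (simp add: W.M.r_neg zero flip: add)
      then show "\<exists>y\<in>carrier Q. x \<oplus>\<^bsub>Q\<^esub> y = \<zero>\<^bsub>Q\<^esub>" using w Q by auto
    qed
  qed (auto simp: Q W.M.a_ac W.smult_l_distr W.smult_r_distr W.smult_assoc1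
        simp flip: add smult zero)
  then interpret Q: vectorspace K Q .
  have "F \<in> module_hom K W Q" using Q by (auto simp: module_hom_def add smult)
  then show ?thesis by unfold_locales
qed

text \<open>This is the first isomorphism theorem in the direction from \<open>W\<close> to the
  quotient: cosets of the kernel are exactly the fibres of \<open>T\<close>, so no representative
  has to be chosen.\<close>

lemma quotient_space_fibres:
  assumes T: "linear_map K V W T" and surj: "T ` carrier V = carrier W"
    and U: "U = {x \<in> carrier V. T x = \<zero>\<^bsub>W\<^esub>}"
  shows "linear_map K W (quotient_space V U) (\<lambda>w. {x \<in> carrier V. T x = w})"
    and "bij_betw (\<lambda>w. {x \<in> carrier V. T x = w}) (carrier W) (carrier (quotient_space V U))"
proof -
  interpret linear_map K V W T by fact
  define F where "F w = {x \<in> carrier V. T x = w}" for w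
  have F_iff: "x \<in> F w \<longleftrightarrow> x \<in> carrier V \<and> T x = w" for x w by (simp add: F_def)
  have F_ex: "\<exists>x. x \<in> F w" if "w \<in> carrier W" for w
    using that unfolding surj[symmetric] by (auto simp: F_iff)
  have FU: "F \<zero>\<^bsub>W\<^esub> = U" by (simp add: F_def U)
  have sum: "F w <+>\<^bsub>V\<^esub> F w' = F (w \<oplus>\<^bsub>W\<^esub> w')" if w: "w \<in> carrier W" "w' \<in> carrier W" for w w'
  proof (intro subset_antisym subsetI)
    fix x assume "x \<in> F w <+>\<^bsub>V\<^esub> F w'"
    then show "x \<in> F (w \<oplus>\<^bsub>W\<^esub> w')" by (auto simp: set_add_def' F_iff T_add)
  next
    \<comment> \<open>Choose any \<open>y\<close> over \<open>w'\<close>; subtracting it from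
      \<open>x\<close> leaves a vector over \<open>w\<close>.\<close>
    fix x assume x: "x \<in> F (w \<oplus>\<^bsub>W\<^esub> w')"
    obtain y where y: "y \<in> F w'" using F_ex w by blast
    have "x = (x \<ominus>\<^bsub>V\<^esub> y) \<oplus>\<^bsub>V\<^esub> y"
      using x y by (simp add: F_iff a_minus_def V.module.M.a_assoc V.module.M.l_neg)
    moreover have "x \<ominus>\<^bsub>V\<^esub> y \<in> F w"
      using x y w by (simp add: F_iff T_minus a_minus_def W.module.M.a_assoc W.module.M.r_neg)
    ultimately show "x \<in> F w <+>\<^bsub>V\<^esub> F w'" using y by (auto simp: set_add_def')
  qed
  have coset: "U +>\<^bsub>V\<^esub> x = F (T x)" if x: "x \<in> carrier V" for x
  proof (intro subset_antisym subsetI)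
    fix y assume "y \<in> U +>\<^bsub>V\<^esub> x"
    then show "y \<in> F (T x)" using x by (auto simp: a_r_coset_def' F_iff U T_add)
  next
    fix y assume y: "y \<in> F (T x)"
    have "y = (y \<ominus>\<^bsub>V\<^esub> x) \<oplus>\<^bsub>V\<^esub> x"
      using x y by (simp add: F_iff a_minus_def V.module.M.a_assoc V.module.M.l_neg)
    moreover have "y \<ominus>\<^bsub>V\<^esub> x \<in> U"
      using x y by (simp add: F_iff U T_minus)
    ultimately show "y \<in> U +>\<^bsub>V\<^esub> x" by (auto simp: a_r_coset_def')
  qed
  have "carrier (quotient_space V U) = (\<lambda>x. U +>\<^bsub>V\<^esub> x) ` carrier V"
    by (auto simp: quotient_space_def A_RCOSETS_def')
  also have "\<dots> = F ` carrier W" using coset by (simp flip: surj add: image_image)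
  finally have carrier: "carrier (quotient_space V U) = F ` carrier W" .
  have smult: "U <+>\<^bsub>V\<^esub> (\<lambda>x. a \<odot>\<^bsub>V\<^esub> x) ` F w = F (a \<odot>\<^bsub>W\<^esub> w)"
    if a: "a \<in> carrier K" and w: "w \<in> carrier W" for a w
  proof (intro subset_antisym subsetI)
    fix x assume "x \<in> U <+>\<^bsub>V\<^esub> (\<lambda>x. a \<odot>\<^bsub>V\<^esub> x) ` F w"
    then show "x \<in> F (a \<odot>\<^bsub>W\<^esub> w)"
      using a w by (auto simp: set_add_def' F_iff U T_add T_smult)
  next
    \<comment> \<open>Dividing \<open>x\<close> by \<open>a\<close> would fail for
      \<open>a = 0\<close>. Instead \<open>x\<close> is compared with the multiple of some
      \<open>y\<close> over \<open>w\<close>, and the difference lies in the kernel.\<close>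
    fix x assume x: "x \<in> F (a \<odot>\<^bsub>W\<^esub> w)"
    obtain y where y: "y \<in> F w" using F_ex w by blast
    have "x = (x \<ominus>\<^bsub>V\<^esub> a \<odot>\<^bsub>V\<^esub> y) \<oplus>\<^bsub>V\<^esub> a \<odot>\<^bsub>V\<^esub> y"
      using x y a by (simp add: F_iff a_minus_def V.module.M.a_assoc V.module.M.l_neg)
    moreover have "x \<ominus>\<^bsub>V\<^esub> a \<odot>\<^bsub>V\<^esub> y \<in> U"
      using x y a w by (simp add: F_iff U T_minus T_smult)
    ultimately show "x \<in> U <+>\<^bsub>V\<^esub> (\<lambda>x. a \<odot>\<^bsub>V\<^esub> x) ` F w" using y by (auto simp: set_add_def')
  qed
  have "inj_on F (carrier W)"
  proof
    fix w w' assume w: "w \<in> carrier W" and eq: "F w = F w'"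
    then obtain x where "x \<in> F w" using F_ex by blast
    then show "w = w'" using eq by (metis F_iff)
  qed
  then have bij: "bij_betw F (carrier W) (carrier (quotient_space V U))"
    by (simp add: bij_betw_def carrier)
  then show "bij_betw (\<lambda>w. {x \<in> carrier V. T x = w}) (carrier W) (carrier (quotient_space V U))"
    by (simp add: F_def[abs_def])
  have "linear_map K W (quotient_space V U) F"
    by (rule linear_map_transport[OF W.vectorspace_axioms bij])
       (simp_all add: quotient_space_def sum smult FU)
  then show "linear_map K W (quotient_space V U) (\<lambda>w. {x \<in> carrier V. T x = w})"
    by (simp add: F_def[abs_def])
qed

section \<open>The tangent space of \<open>G/H\<close>\<close>

lemma GL_iff: "A \<in> carrier (GL n) \<longleftrightarrow> A \<in> carrier_mat n n \<and> det A \<noteq> 0"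
proof -
  have "A \<in> carrier_mat n n" if "A \<in> Units (ring_mat TYPE(complex) n ())"
    using that by (simp add: Units_def ring_mat_simps)
  then show ?thesis
    using unit_imp_det_non_zero[of A n "()"] det_non_zero_imp_unit[of A n "()"]
    by (auto simp: GL_def units_of_carrier)
qed

lemma group_GL: "group (GL n)"
proof -
  interpret ring "ring_mat TYPE(complex) n ()" by (rule ring_mat)
  show ?thesis unfolding GL_def by (rule units_group)
qed

lemma GL_simps: "mult (GL n) = (*)" "one (GL n) = 1\<^sub>m n"
  by (simp_all add: GL_def units_of_mult units_of_one ring_mat_simps)

lemma grpG_iff: "p \<in> carrier (grpG r s) \<longleftrightarrow> fst p \<in> carrier (GL r) \<and> snd p \<in> carrier (GL s)"
  by (cases p) (simp add: grpG_def)

lemma grpG_simps: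
  "p \<otimes>\<^bsub>grpG r s\<^esub> q = (fst p * fst q, snd p * snd q)"
  "\<one>\<^bsub>grpG r s\<^esub> = (1\<^sub>m r, 1\<^sub>m s)"
  by (simp_all add: grpG_def mult_DirProd' GL_simps)

lemma group_grpG: "group (grpG r s)"
  unfolding grpG_def by (intro DirProd_group group_GL)

text \<open>The functions \<open>\<lambda>p. defect r p q\<close> with \<open>q \<in> gap r s\<close> are the linear coordinates on
  \<open>\<gg>/\<hh>\<close>.\<close>

definition gap :: "nat \<Rightarrow> nat \<Rightarrow> (nat \<times> nat) set" where
  "gap r s = {(i, j). i < s \<and> j < s \<and> (i < r \<or> j < r)}"

definition defect :: "nat \<Rightarrow> complex mat \<times> complex mat \<Rightarrow> nat \<times> nat \<Rightarrow> complex" where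
  "defect r p q = snd p $$ q - (if fst q < r \<and> snd q < r then fst p $$ q else 0)"

text \<open>Given the equations, D is read off as the lower right block. Its invertibility is
  automatic: the block shape forces \<open>det B = det A * det D\<close>.\<close>

lemma grpH_iff:
  assumes "r \<le> s"
  shows "p \<in> grpH r s \<longleftrightarrow> p \<in> carrier (grpG r s) \<and> (\<forall>q\<in>gap r s. defect r p q = 0)"
proof -
  obtain A B where p: "p = (A, B)" by fastforce
  have "(\<exists>D\<in>carrier (GL (s - r)). B = four_block_mat A (0\<^sub>m r (s - r)) (0\<^sub>m (s - r) r) D)
    \<longleftrightarrow> (\<forall>q\<in>gap r s. defect r p q = 0)" (is "?L \<longleftrightarrow> ?R")
    if A: "A \<in> carrier (GL r)" and B: "B \<in> carrier (GL s)"
  proof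
    assume ?L
    then obtain D where D: "D \<in> carrier_mat (s - r) (s - r)"
      and B_eq: "B = four_block_mat A (0\<^sub>m r (s - r)) (0\<^sub>m (s - r) r) D"
      by (auto simp: GL_iff)
    show ?R
      using A D assms by (auto simp: gap_def defect_def p B_eq GL_iff)
  next
    assume R: ?R
    define D where "D = mat (s - r) (s - r) (\<lambda>(i, j). B $$ (i + r, j + r))"
    have B_eq: "B = four_block_mat A (0\<^sub>m r (s - r)) (0\<^sub>m (s - r) r) D"
    proof (rule eq_matI)
      fix i j assume "i < dim_row (four_block_mat A (0\<^sub>m r (s - r)) (0\<^sub>m (s - r) r) D)"
        "j < dim_col (four_block_mat A (0\<^sub>m r (s - r)) (0\<^sub>m (s - r) r) D)"
      then have ij: "i < s" "j < s" using A assms by (auto simp: GL_iff D_def)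
      show "B $$ (i, j) = four_block_mat A (0\<^sub>m r (s - r)) (0\<^sub>m (s - r) r) D $$ (i, j)"
        using R[rule_format, of "(i, j)"] ij A assms
        by (auto simp: gap_def defect_def p D_def GL_iff)
    qed (use A B assms in \<open>auto simp: GL_iff D_def\<close>)
    have D: "D \<in> carrier_mat (s - r) (s - r)" by (simp add: D_def)
    have "det B = det A * det D"
      using A D unfolding B_eq by (intro det_four_block_mat_upper_right_zero) (auto simp: GL_iff)
    then have "D \<in> carrier (GL (s - r))" using B D by (auto simp: GL_iff)
    then show ?L using B_eq by blast
  qed
  then show ?thesis by (auto simp: grpH_def grpG_iff p)
qed

lemma mat_pairs_simps:
  "carrier (mat_pairs r s) = carrier_mat r r \<times> carrier_mat s s"
  "add (mat_pairs r s) = (\<lambda>p q. (fst p + fst q, snd p + snd q))"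
  "smult (mat_pairs r s) = (\<lambda>c p. (c \<cdot>\<^sub>m fst p, c \<cdot>\<^sub>m snd p))"
  by (simp_all add: mat_pairs_def direct_sum_def module_mat_simps)

lemma vectorspace_mat_pairs: "vectorspace class_ring (mat_pairs r s)"
  unfolding mat_pairs_def by (intro direct_sum_is_vs matrix_vs)

lemma eventually_one_plus_smult_GL:
  assumes X: "X \<in> carrier_mat n n"
  shows "\<forall>\<^sub>F z in nhds 0. 1\<^sub>m n + z \<cdot>\<^sub>m X \<in> carrier (GL n)"
proof -
  let ?d = "\<lambda>z. det (1\<^sub>m n + z \<cdot>\<^sub>m X)"
  \<comment> \<open>The Leibniz expansion displays the determinant as a polynomial in
    \<open>z\<close>, hence continuous; at 0 its value is 1.\<close>
  have d: "?d z = (\<Sum>p\<in>{p. p permutes {0..<n}}.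
      signof p * (\<Prod>i=0..<n. (if i = p i then 1 else 0) + z * X $$ (i, p i)))" for z
  proof -
    have "?d z = (\<Sum>p\<in>{p. p permutes {0..<n}}.
      signof p * (\<Prod>i=0..<n. (1\<^sub>m n + z \<cdot>\<^sub>m X) $$ (i, p i)))"
      using X by (intro det_def') auto
    also have "\<dots> = (\<Sum>p\<in>{p. p permutes {0..<n}}.
      signof p * (\<Prod>i=0..<n. (if i = p i then 1 else 0) + z * X $$ (i, p i)))"
      using X by (intro sum.cong prod.cong arg_cong2[of _ _ _ _ "(*)"]) (auto simp: permutes_in_image)
    finally show ?thesis .
  qed
  have "isCont ?d 0" unfolding d by (intro continuous_intros)
  then have "(?d \<longlongrightarrow> ?d 0) (nhds 0)"
    unfolding isCont_def by (rule tendsto_at_iff_tendsto_nhds[THEN iffD1])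
  moreover have "1\<^sub>m n + 0 \<cdot>\<^sub>m X = 1\<^sub>m n" using X by (intro eq_matI) auto
  ultimately have "\<forall>\<^sub>F z in nhds 0. ?d z \<noteq> 0"
    by (intro tendsto_imp_eventually_ne[where c="?d 0"]) auto
  then show ?thesis by eventually_elim (use X in \<open>simp add: GL_iff\<close>)
qed

lemma has_velocity_one_plus_smult:
  assumes X: "X \<in> carrier_mat n n"
  shows "has_velocity n e (\<lambda>z. 1\<^sub>m n + z \<cdot>\<^sub>m X) X"
  unfolding has_velocity_def
proof (intro allI impI)
  fix i j assume ij: "i < n" "j < n"
  have eq: "(\<lambda>z. (1\<^sub>m n + z \<cdot>\<^sub>m X) $$ (i, j)) = (\<lambda>z. (if i = j then 1 else 0) + z * X $$ (i, j))"
    using ij X by auto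
  show "(\<lambda>z. (1\<^sub>m n + z \<cdot>\<^sub>m X) $$ (i, j)) holomorphic_on ball 0 e \<and>
    ((\<lambda>z. (1\<^sub>m n + z \<cdot>\<^sub>m X) $$ (i, j)) has_field_derivative X $$ (i, j)) (at 0)"
    unfolding eq by (auto intro!: holomorphic_intros derivative_eq_intros)
qed

text \<open>The curve is the straight line through the identity. Near 0 it stays in G, so membership
  in \<open>K\<close> need only be checked at points already known to lie in G.\<close>

lemma lie_algI:
  assumes X: "X \<in> carrier_mat r r" and Y: "Y \<in> carrier_mat s s"
    and K: "\<And>z. (1\<^sub>m r + z \<cdot>\<^sub>m X, 1\<^sub>m s + z \<cdot>\<^sub>m Y) \<in> carrier (grpG r s) \<Longrightarrow>
      (1\<^sub>m r + z \<cdot>\<^sub>m X, 1\<^sub>m s + z \<cdot>\<^sub>m Y) \<in> K"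
  shows "(X, Y) \<in> lie_alg r s K"
proof -
  let ?\<gamma> = "\<lambda>z. (1\<^sub>m r + z \<cdot>\<^sub>m X, 1\<^sub>m s + z \<cdot>\<^sub>m Y)"
  have "\<forall>\<^sub>F z in nhds 0. ?\<gamma> z \<in> K"
    using eventually_one_plus_smult_GL[OF X] eventually_one_plus_smult_GL[OF Y]
    by eventually_elim (simp add: K grpG_iff)
  then obtain e where e: "e > 0" "\<And>z. dist z 0 < e \<Longrightarrow> ?\<gamma> z \<in> K"
    by (auto simp: eventually_nhds_metric)
  have "?\<gamma> 0 = \<one>\<^bsub>grpG r s\<^esub>"
    using X Y by (auto simp: grpG_simps intro!: eq_matI)
  then have "\<exists>e>0. \<exists>\<gamma>. \<gamma> 0 = \<one>\<^bsub>grpG r s\<^esub> \<and> (\<forall>z\<in>ball 0 e. \<gamma> z \<in> K) \<and>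
      has_velocity r e (\<lambda>z. fst (\<gamma> z)) X \<and> has_velocity s e (\<lambda>z. snd (\<gamma> z)) Y"
    using e has_velocity_one_plus_smult[OF X] has_velocity_one_plus_smult[OF Y]
    by (intro exI[of _ e] exI[of _ ?\<gamma>] conjI) (auto simp: dist_commute)
  then show ?thesis using X Y by (simp add: lie_alg_def mat_pairs_simps)
qed

lemma lie_alg_grpG: "lie_alg r s (carrier (grpG r s)) = carrier (mat_pairs r s)"
  using lie_algI by (auto simp: lie_alg_def mat_pairs_simps)

lemma lie_alg_grpH:
  assumes rs: "r \<le> s"
  shows "lie_alg r s (grpH r s) = {p \<in> carrier (mat_pairs r s). \<forall>q\<in>gap r s. defect r p q = 0}"
proof (intro subset_antisym subsetI CollectI conjI ballI)
  fix p q assume p: "p \<in> lie_alg r s (grpH r s)" and q: "q \<in> gap r s"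
  obtain X Y where XY: "p = (X, Y)" by fastforce
  from p obtain e \<gamma> where e: "e > 0" and \<gamma>: "\<And>z. z \<in> ball 0 e \<Longrightarrow> \<gamma> z \<in> grpH r s"
    and vX: "has_velocity r e (\<lambda>z. fst (\<gamma> z)) X" and vY: "has_velocity s e (\<lambda>z. snd (\<gamma> z)) Y"
    unfolding lie_alg_def XY by blast
  obtain i j where ij: "q = (i, j)" "i < s" "j < s" using q by (auto simp: gap_def)
  \<comment> \<open>The defect is linear in the pair of matrices, so its derivative along the curve
    is the defect of the velocity. It is also 0, because the curve stays in H.\<close>
  have "((\<lambda>z. defect r (\<gamma> z) q) has_field_derivative defect r p q) (at 0)"
  proof (cases "i < r \<and> j < r")
    case True
    then show ?thesis
      using vX vY ij by (auto simp: defect_def XY has_velocity_def intro!: derivative_intros)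
  next
    case False
    then show ?thesis
      using vY ij by (auto simp: defect_def XY has_velocity_def)
  qed
  moreover have "((\<lambda>z. defect r (\<gamma> z) q) has_field_derivative 0) (at 0)"
  proof (rule has_field_derivative_transform_within_open[of "\<lambda>_. 0"])
    show "0 \<in> ball (0::complex) e" using e by simp
    show "0 = defect r (\<gamma> z) q" if "z \<in> ball 0 e" for z
      using \<gamma>[OF that] q rs by (simp add: grpH_iff)
  qed auto
  ultimately show "defect r p q = 0" by (rule DERIV_unique)
next
  fix p assume "p \<in> {p \<in> carrier (mat_pairs r s). \<forall>q\<in>gap r s. defect r p q = 0}"
  then obtain X Y where XY: "p = (X, Y)" "X \<in> carrier_mat r r" "Y \<in> carrier_mat s s"
    and d: "\<And>q. q \<in> gap r s \<Longrightarrow> defect r (X, Y) q = 0"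
    by (auto simp: mat_pairs_simps)
  \<comment> \<open>The identity pair has defect 0 on \<open>gap r s\<close>, so only the linear
    term survives.\<close>
  have "defect r (1\<^sub>m r + z \<cdot>\<^sub>m X, 1\<^sub>m s + z \<cdot>\<^sub>m Y) q = z * defect r (X, Y) q"
    if "q \<in> gap r s" for z q
    using that XY by (auto simp: gap_def defect_def algebra_simps)
  then show "p \<in> lie_alg r s (grpH r s)"
    unfolding XY(1) using XY rs d by (intro lie_algI) (auto simp: grpH_iff)
qed (auto simp: lie_alg_def)

section \<open>Coordinates on the tangent space\<close>

definition gap_vec :: "nat \<Rightarrow> nat \<Rightarrow> (nat \<Rightarrow> nat \<times> nat) \<Rightarrow> complex mat \<times> complex mat \<Rightarrow> complex vec" where
  "gap_vec r n h p = vec n (\<lambda>k. defect r p (h k))"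

lemma linear_map_gap_vec:
  assumes h: "bij_betw h {..<n} (gap r s)"
  shows "linear_map class_ring (mat_pairs r s) (module_vec TYPE(complex) n) (gap_vec r n h)"
proof -
  interpret V: vectorspace "class_ring :: complex ring" "mat_pairs r s"
    by (rule vectorspace_mat_pairs)
  interpret W: vectorspace "class_ring :: complex ring" "module_vec TYPE(complex) n"
    by (rule vec_vs)
  have h_gap: "h k \<in> gap r s" if "k < n" for k using h that by (auto simp: bij_betw_def)
  have "gap_vec r n h (p \<oplus>\<^bsub>mat_pairs r s\<^esub> p') = gap_vec r n h p + gap_vec r n h p'"
    if p: "p \<in> carrier (mat_pairs r s)" "p' \<in> carrier (mat_pairs r s)" for p p'
  proof (rule eq_vecI)
    fix k assume "k < dim_vec (gap_vec r n h p + gap_vec r n h p')"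
    then have "k < n" by (simp add: gap_vec_def)
    then show "gap_vec r n h (p \<oplus>\<^bsub>mat_pairs r s\<^esub> p') $ k = (gap_vec r n h p + gap_vec r n h p') $ k"
      using h_gap[of k] p by (auto simp: gap_vec_def defect_def gap_def mat_pairs_simps)
  qed (simp add: gap_vec_def)
  moreover have "gap_vec r n h (c \<odot>\<^bsub>mat_pairs r s\<^esub> p) = c \<cdot>\<^sub>v gap_vec r n h p"
    if p: "p \<in> carrier (mat_pairs r s)" for c p
  proof (rule eq_vecI)
    fix k assume "k < dim_vec (c \<cdot>\<^sub>v gap_vec r n h p)"
    then have "k < n" by (simp add: gap_vec_def)
    then show "gap_vec r n h (c \<odot>\<^bsub>mat_pairs r s\<^esub> p) $ k = (c \<cdot>\<^sub>v gap_vec r n h p) $ k"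
      using h_gap[of k] p
      by (auto simp: gap_vec_def defect_def gap_def mat_pairs_simps algebra_simps)
  qed (simp add: gap_vec_def)
  moreover have "gap_vec r n h p \<in> carrier_vec n" for p by (simp add: gap_vec_def)
  ultimately have "gap_vec r n h \<in> module_hom class_ring (mat_pairs r s) (module_vec TYPE(complex) n)"
    by (simp add: module_hom_def module_vec_simps)
  then show ?thesis by unfold_locales
qed

lemma gap_vec_surj:
  assumes h: "bij_betw h {..<n} (gap r s)"
  shows "gap_vec r n h ` carrier (mat_pairs r s) = carrier_vec n"
proof (intro subset_antisym subsetI)
  fix w :: "complex vec" assume w: "w \<in> carrier_vec n"
  \<comment> \<open>With first component 0 the defect is just an entry of the second. Outside
    \<open>gap r s\<close> these entries are unspecified values of \<open>inv_into\<close>, which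
    \<open>gap_vec\<close> does not read.\<close>
  let ?p = "(0\<^sub>m r r, mat s s (\<lambda>q. w $ inv_into {..<n} h q))"
  have "gap_vec r n h ?p = w"
  proof (rule eq_vecI)
    fix k assume "k < dim_vec w"
    then have k: "k < n" using w by simp
    then have hk: "h k \<in> gap r s" "inv_into {..<n} h (h k) = k"
      using h by (auto simp: bij_betw_def)
    then show "gap_vec r n h ?p $ k = w $ k"
      using k by (auto simp: gap_vec_def defect_def gap_def)
  qed (use w in \<open>simp add: gap_vec_def\<close>)
  then show "w \<in> gap_vec r n h ` carrier (mat_pairs r s)"
    by (intro image_eqI[of _ _ ?p]) (auto simp: mat_pairs_simps)
qed (auto simp: gap_vec_def)

text \<open>For \<open>r \<le> s\<close>, an enumeration \<open>h\<close> of the gap and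
  \<open>w\<close> in C^n, this is the coset with coordinate vector \<open>w\<close>, that is, a
  point of the tangent space.\<close>

definition fibre :: "nat \<Rightarrow> nat \<Rightarrow> nat \<Rightarrow> (nat \<Rightarrow> nat \<times> nat) \<Rightarrow> complex vec \<Rightarrow>
   (complex mat \<times> complex mat) set" where
  "fibre r s n h w = {p \<in> carrier (mat_pairs r s). gap_vec r n h p = w}"

lemma tangent_GH_fibre:
  assumes rs: "r \<le> s" and h: "bij_betw h {..<n} (gap r s)"
  shows "linear_map class_ring (module_vec TYPE(complex) n) (tangent_GH r s) (fibre r s n h)"
    and "bij_betw (fibre r s n h) (carrier_vec n) (carrier (tangent_GH r s))"
proof -
  have "gap r s = h ` {..<n}" using h by (simp add: bij_betw_def)
  then have "(\<forall>q\<in>gap r s. defect r p q = 0) \<longleftrightarrow> gap_vec r n h p = 0\<^sub>v n" for p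
    by (auto simp: gap_vec_def vec_eq_iff)
  then have "lie_alg r s (grpH r s) =
    {p \<in> carrier (mat_pairs r s). gap_vec r n h p = \<zero>\<^bsub>module_vec TYPE(complex) n\<^esub>}"
    by (simp add: lie_alg_grpH[OF rs] module_vec_simps)
  from quotient_space_fibres[OF linear_map_gap_vec[OF h] _ this]
  show "linear_map class_ring (module_vec TYPE(complex) n) (tangent_GH r s) (fibre r s n h)"
    and "bij_betw (fibre r s n h) (carrier_vec n) (carrier (tangent_GH r s))"
    using gap_vec_surj[OF h]
    by (simp_all add: tangent_GH_def lie_alg_grpG fibre_def[abs_def] module_vec_simps)
qed

section \<open>The action of the torus\<close>

lemma diagonal_mat_mult_left:
  assumes "diagonal_mat A" "A \<in> carrier_mat n n" "B \<in> carrier_mat n m" "i < n" "j < m"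
  shows "(A * B) $$ (i, j) = A $$ (i, i) * B $$ (i, j)"
proof -
  have "(A * B) $$ (i, j) = (\<Sum>k\<in>{0..<n}. A $$ (i, k) * B $$ (k, j))"
    using assms by (simp add: scalar_prod_def)
  also have "\<dots> = (\<Sum>k\<in>{i}. A $$ (i, k) * B $$ (k, j))"
    using assms by (intro sum.mono_neutral_right) (auto simp: diagonal_mat_def)
  finally show ?thesis by simp
qed

lemma diagonal_mat_mult_right:
  assumes "diagonal_mat A" "A \<in> carrier_mat n n" "B \<in> carrier_mat m n" "i < m" "j < n"
  shows "(B * A) $$ (i, j) = B $$ (i, j) * A $$ (j, j)"
proof -
  have "(B * A) $$ (i, j) = (\<Sum>k\<in>{0..<n}. B $$ (i, k) * A $$ (k, j))"
    using assms by (simp add: scalar_prod_def)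
  also have "\<dots> = (\<Sum>k\<in>{j}. B $$ (i, k) * A $$ (k, j))"
    using assms by (intro sum.mono_neutral_right) (auto simp: diagonal_mat_def)
  finally show ?thesis by simp
qed

lemma diagonal_inverse:
  fixes A A' :: "'a :: field mat"
  assumes A: "diagonal_mat A" "A \<in> carrier_mat n n" and A': "A' \<in> carrier_mat n n"
    and eq: "A * A' = 1\<^sub>m n"
  shows "diagonal_mat A'" and "i < n \<Longrightarrow> A $$ (i, i) \<noteq> 0"
    and "i < n \<Longrightarrow> A' $$ (i, i) = 1 / A $$ (i, i)"
proof -
  have *: "A $$ (i, i) * A' $$ (i, j) = (if i = j then 1 else 0)" if "i < n" "j < n" for i j
    using diagonal_mat_mult_left[OF A A' that] that by (simp add: eq)
  show nz: "i < n \<Longrightarrow> A $$ (i, i) \<noteq> 0" for i using *[of i i] by auto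
  show "i < n \<Longrightarrow> A' $$ (i, i) = 1 / A $$ (i, i)" using *[of i i] nz by (simp add: field_simps)
  show "diagonal_mat A'" using * nz A' by (fastforce simp: diagonal_mat_def)
qed

text \<open>The first formula is conjugation by a torus element, used to exploit normalisation; the
  second is conjugation by its inverse, as it occurs in the contragredient action.\<close>

lemma diagonal_conj:
  fixes A A' C :: "'a :: field mat"
  assumes A: "diagonal_mat A" "A \<in> carrier_mat n n" and A': "A' \<in> carrier_mat n n"
    and eq: "A * A' = 1\<^sub>m n" and C: "C \<in> carrier_mat n n" and ij: "i < n" "j < n"
  shows "(A * C * A') $$ (i, j) = A $$ (i, i) * C $$ (i, j) / A $$ (j, j)"
    and "(A' * C * A) $$ (i, j) = A $$ (j, j) * C $$ (i, j) / A $$ (i, i)"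
  using assms diagonal_inverse[OF A A' eq]
  by (simp_all add: diagonal_mat_mult_left[where n=n and m=n] diagonal_mat_mult_right[where n=n and m=n]
      del: index_mult_mat(1))

lemma conj_conj_inverse:
  fixes P Q X :: "'a :: semiring_1 mat"
  assumes "P \<in> carrier_mat n n" "Q \<in> carrier_mat n n" "X \<in> carrier_mat n n" "P * Q = 1\<^sub>m n"
  shows "P * (Q * X * P) * Q = X"
proof -
  have "P * (Q * X * P) * Q = (P * Q) * X * (P * Q)"
    using assms(1-3) by (simp add: assoc_mult_mat[of _ n n _ n _ n])
  then show ?thesis using assms by simp
qed

lemma torus_inv:
  assumes t: "t \<in> torus r s"
  obtains A A' B B' where "t = (A, B)" "inv\<^bsub>grpG r s\<^esub> (A, B) = (A', B')"
    "inv\<^bsub>grpG r s\<^esub> (A', B') = (A, B)"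
    "diagonal_mat A" "A \<in> carrier_mat r r" "A' \<in> carrier_mat r r" "A * A' = 1\<^sub>m r"
    "diagonal_mat B" "B \<in> carrier_mat s s" "B' \<in> carrier_mat s s" "B * B' = 1\<^sub>m s"
proof -
  interpret G: group "grpG r s" by (rule group_grpG)
  have tG: "t \<in> carrier (grpG r s)" using t by (auto simp: torus_def)
  obtain A B A' B' where eq: "t = (A, B)" "inv\<^bsub>grpG r s\<^esub> (A, B) = (A', B')" by fastforce
  have "(A', B') \<in> carrier (grpG r s)" using G.inv_closed[OF tG] eq by simp
  moreover have "(A * A', B * B') = (1\<^sub>m r, 1\<^sub>m s)"
    using G.r_inv[OF tG] by (simp add: eq grpG_simps)
  moreover have "inv\<^bsub>grpG r s\<^esub> (A', B') = (A, B)" using G.inv_inv[OF tG] eq by simp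
  ultimately show ?thesis
    using that[of A B A' B'] t tG eq by (auto simp: torus_def grpG_iff GL_iff)
qed

text \<open>Conjugating an elementary matrix \<open>1 + E\<^sub>i\<^sub>j\<close>, embedded in \<open>H\<close>, shows that the two diagonal
  blocks of a normalising torus element have the same root values.\<close>

lemma torusH_ratio:
  assumes rs: "r \<le> s" and t: "t \<in> torusH r s" and ij: "i < r" "j < r"
  shows "fst t $$ (i, i) / fst t $$ (j, j) = snd t $$ (i, i) / snd t $$ (j, j)"
proof (cases "i = j")
  case True
  have "t \<in> torus r s" using t by (simp add: torusH_def)
  then obtain A A' B B' where "t = (A, B)"
    "diagonal_mat A" "A \<in> carrier_mat r r" "A' \<in> carrier_mat r r" "A * A' = 1\<^sub>m r"
    "diagonal_mat B" "B \<in> carrier_mat s s" "B' \<in> carrier_mat s s" "B * B' = 1\<^sub>m s"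
    by (rule torus_inv)
  then show ?thesis using True ij rs diagonal_inverse(2)[of A r A' i] diagonal_inverse(2)[of B s B' i]
    by simp
next
  case False
  have "t \<in> torus r s" using t by (simp add: torusH_def)
  then obtain A A' B B' where t_eq: "t = (A, B)" "inv\<^bsub>grpG r s\<^esub> (A, B) = (A', B')"
    and A: "diagonal_mat A" "A \<in> carrier_mat r r" "A' \<in> carrier_mat r r" "A * A' = 1\<^sub>m r"
    and B: "diagonal_mat B" "B \<in> carrier_mat s s" "B' \<in> carrier_mat s s" "B * B' = 1\<^sub>m s"
    by (rule torus_inv)
  let ?C = "addrow_mat r 1 i j :: complex mat" and ?D = "addrow_mat s 1 i j :: complex mat"
  have "(?C, ?D) \<in> carrier (grpG r s)"
    using False by (simp add: grpG_iff GL_iff det_addrow_mat)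
  moreover have "defect r (?C, ?D) q = 0" if "q \<in> gap r s" for q
    using that ij rs by (auto simp: gap_def defect_def addrow_mat_def)
  ultimately have CD: "(?C, ?D) \<in> grpH r s" by (simp add: grpH_iff[OF rs])
  \<comment> \<open>The action behind \<open>normalizer\<close> is defined on subsets of the carrier
    only; this inclusion allows it to be unfolded.\<close>
  have "grpH r s \<subseteq> carrier (grpG r s)" using grpH_iff[OF rs] by blast
  then have "t <#\<^bsub>grpG r s\<^esub> grpH r s #>\<^bsub>grpG r s\<^esub> inv\<^bsub>grpG r s\<^esub> t = grpH r s"
    using t by (simp add: torusH_def normalizer_def stabilizer_def)
  moreover have "t \<otimes>\<^bsub>grpG r s\<^esub> (?C, ?D) \<otimes>\<^bsub>grpG r s\<^esub> inv\<^bsub>grpG r s\<^esub> t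
      \<in> t <#\<^bsub>grpG r s\<^esub> grpH r s #>\<^bsub>grpG r s\<^esub> inv\<^bsub>grpG r s\<^esub> t"
    using CD by (auto simp: l_coset_def r_coset_def)
  ultimately have "(A * ?C * A', B * ?D * B') \<in> grpH r s"
    by (simp add: t_eq grpG_simps)
  then have "defect r (A * ?C * A', B * ?D * B') (i, j) = 0"
    using ij rs by (auto simp: grpH_iff[OF rs] gap_def)
  moreover have "(A * ?C * A') $$ (i, j) = A $$ (i, i) * ?C $$ (i, j) / A $$ (j, j)"
    using A ij by (intro diagonal_conj) auto
  moreover have "(B * ?D * B') $$ (i, j) = B $$ (i, i) * ?D $$ (i, j) / B $$ (j, j)"
    using B ij rs by (intro diagonal_conj[where n=s]) auto
  moreover have "?C $$ (i, j) = 1" "?D $$ (i, j) = 1"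
    using ij rs False by (simp_all add: addrow_mat_def)
  ultimately show ?thesis using ij by (simp add: defect_def t_eq)
qed

section \<open>Weights on the tangent space and their product\<close>

definition weight :: "complex mat \<times> complex mat \<Rightarrow> nat \<times> nat \<Rightarrow> complex" where
  "weight t q = snd t $$ (snd q, snd q) / snd t $$ (fst q, fst q)"

lemma weight_nonzero:
  assumes "t \<in> torus r s" "q \<in> gap r s"
  shows "weight t q \<noteq> 0"
proof -
  from assms(1) obtain A A' B B' where "t = (A, B)"
    and B: "diagonal_mat B" "B \<in> carrier_mat s s" "B' \<in> carrier_mat s s" "B * B' = 1\<^sub>m s"
    by (rule torus_inv)
  then show ?thesis
    using assms(2) diagonal_inverse(2)[OF B] by (auto simp: weight_def gap_def)
qed

lemma prod_weight:
  assumes "t \<in> torus r s"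
  shows "(\<Prod>q\<in>gap r s. weight t q) = 1"
proof -
  from assms obtain A A' B B' where t: "t = (A, B)"
    and B: "diagonal_mat B" "B \<in> carrier_mat s s" "B' \<in> carrier_mat s s" "B * B' = 1\<^sub>m s"
    by (rule torus_inv)
  let ?b = "\<lambda>i. B $$ (i, i)"
  have fin: "finite (gap r s)"
    by (rule finite_subset[of _ "{..<s} \<times> {..<s}"]) (auto simp: gap_def)
  \<comment> \<open>Interchanging row and column index matches the numerators with the
    denominators.\<close>
  have "(\<Prod>q\<in>gap r s. ?b (snd q)) = (\<Prod>q\<in>gap r s. ?b (fst q))"
    by (rule prod.reindex_bij_witness[of _ prod.swap prod.swap]) (auto simp: gap_def)
  moreover have "(\<Prod>q\<in>gap r s. ?b (fst q)) \<noteq> 0"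
    using fin diagonal_inverse(2)[OF B] by (auto simp: gap_def)
  ultimately show ?thesis by (simp add: weight_def t prod_dividef)
qed

text \<open>The third claim is there because \<open>Ad_tangent\<close> takes the image of a coset:
  surjectivity ensures that this image fills a whole coset. The preimage is found by conjugating
  with \<open>t\<close> itself.\<close>

lemma Ad_inv:
  assumes rs: "r \<le> s" and t: "t \<in> torusH r s" and p: "p \<in> carrier (mat_pairs r s)"
  shows "Ad r s (inv\<^bsub>grpG r s\<^esub> t) p \<in> carrier (mat_pairs r s)"
    and "q \<in> gap r s \<Longrightarrow> defect r (Ad r s (inv\<^bsub>grpG r s\<^esub> t) p) q = weight t q * defect r p q"
    and "\<exists>p'\<in>carrier (mat_pairs r s). Ad r s (inv\<^bsub>grpG r s\<^esub> t) p' = p"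
proof -
  have "t \<in> torus r s" using t by (simp add: torusH_def)
  then obtain A A' B B' where t_eq: "t = (A, B)" "inv\<^bsub>grpG r s\<^esub> (A, B) = (A', B')"
    "inv\<^bsub>grpG r s\<^esub> (A', B') = (A, B)"
    and A: "diagonal_mat A" "A \<in> carrier_mat r r" "A' \<in> carrier_mat r r" "A * A' = 1\<^sub>m r"
    and B: "diagonal_mat B" "B \<in> carrier_mat s s" "B' \<in> carrier_mat s s" "B * B' = 1\<^sub>m s"
    by (rule torus_inv)
  have Ad: "Ad r s (inv\<^bsub>grpG r s\<^esub> t) x = (A' * fst x * A, B' * snd x * B)" for x
    by (simp add: Ad_def t_eq)
  obtain X Y where XY: "p = (X, Y)" "X \<in> carrier_mat r r" "Y \<in> carrier_mat s s"
    using p by (auto simp: mat_pairs_simps)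
  show "Ad r s (inv\<^bsub>grpG r s\<^esub> t) p \<in> carrier (mat_pairs r s)"
    using A B XY unfolding Ad by (auto simp: mat_pairs_simps)
  show "defect r (Ad r s (inv\<^bsub>grpG r s\<^esub> t) p) q = weight t q * defect r p q" if q: "q \<in> gap r s"
  proof -
    obtain i j where ij: "q = (i, j)" "i < s" "j < s" using q by (auto simp: gap_def)
    have Y: "(B' * Y * B) $$ (i, j) = B $$ (j, j) * Y $$ (i, j) / B $$ (i, i)"
      using B XY ij by (intro diagonal_conj[where n=s]) auto
    show ?thesis
    proof (cases "i < r \<and> j < r")
      case True
      have "(A' * X * A) $$ (i, j) = A $$ (j, j) * X $$ (i, j) / A $$ (i, i)"
        using A XY True by (intro diagonal_conj) auto
      also have "\<dots> = (A $$ (j, j) / A $$ (i, i)) * X $$ (i, j)" by simp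
      \<comment> \<open>Here \<open>t\<close> must normalise H: only then do the entries of X and Y
        carry the same factor, which can be taken out of their difference.\<close>
      also have "\<dots> = (B $$ (j, j) / B $$ (i, i)) * X $$ (i, j)"
        using torusH_ratio[OF rs t, of j i] True by (simp add: t_eq)
      finally show ?thesis
        using True Y unfolding Ad by (simp add: defect_def weight_def XY ij t_eq algebra_simps diff_divide_distrib)
    next
      case False
      then show ?thesis
        using Y unfolding Ad by (auto simp: defect_def weight_def XY ij t_eq)
    qed
  qed
  have "A' * A = 1\<^sub>m r" "B' * B = 1\<^sub>m s"
    using A B mat_mult_left_right_inverse by blast+
  then have "A' * (A * X * A') * A = X" "B' * (B * Y * B') * B = Y"
    using A B XY conj_conj_inverse by blast+
  then show "\<exists>p'\<in>carrier (mat_pairs r s). Ad r s (inv\<^bsub>grpG r s\<^esub> t) p' = p"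
    using A B XY unfolding Ad
    by (intro bexI[of _ "(A * X * A', B * Y * B')"]) (auto simp: mat_pairs_simps)
qed

lemma Ad_tangent_fibre:
  assumes rs: "r \<le> s" and h: "bij_betw h {..<n} (gap r s)" and t: "t \<in> torusH r s"
    and w: "w \<in> carrier_vec n"
  shows "Ad_tangent r s (inv\<^bsub>grpG r s\<^esub> t) (fibre r s n h w) =
    fibre r s n h (vec n (\<lambda>k. weight t (h k) * w $ k))"
proof -
  let ?Ad = "Ad r s (inv\<^bsub>grpG r s\<^esub> t)"
  have h_gap: "h k \<in> gap r s" if "k < n" for k using h that by (auto simp: bij_betw_def)
  \<comment> \<open>Nonzero weights can be cancelled, so that a pair lies over \<open>w\<close> if
    and only if its image lies over the rescaled vector.\<close>
  have nz: "weight t (h k) \<noteq> 0" if "k < n" for k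
    using weight_nonzero[OF _ h_gap[OF that]] t by (auto simp: torusH_def)
  have fibre_Ad: "?Ad p \<in> fibre r s n h (vec n (\<lambda>k. weight t (h k) * w $ k)) \<longleftrightarrow> p \<in> fibre r s n h w"
    if p: "p \<in> carrier (mat_pairs r s)" for p
    using Ad_inv(1)[OF rs t p] Ad_inv(2)[OF rs t p h_gap] p w nz
    by (auto simp: fibre_def gap_vec_def vec_eq_iff)
  show ?thesis unfolding Ad_tangent_def
  proof (intro subset_antisym subsetI)
    fix p assume "p \<in> ?Ad ` fibre r s n h w"
    then obtain p' where "p = ?Ad p'" "p' \<in> fibre r s n h w" by blast
    then show "p \<in> fibre r s n h (vec n (\<lambda>k. weight t (h k) * w $ k))"
      using fibre_Ad[of p'] by (simp add: fibre_def)
  next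
    fix p assume p: "p \<in> fibre r s n h (vec n (\<lambda>k. weight t (h k) * w $ k))"
    then obtain p' where "p' \<in> carrier (mat_pairs r s)" "?Ad p' = p"
      using Ad_inv(3)[OF rs t, of p] unfolding fibre_def by blast
    then show "p \<in> ?Ad ` fibre r s n h w"
      using fibre_Ad[of p'] p by blast
  qed
qed

theorem theorem1:
  fixes r s :: nat
  assumes "1 \<le> r" and "r \<le> s"
  shows "vectorspace.dim class_ring (canonical_fibre r s) = 1 \<and>
         acts_by_character (torusH r s) (canonical_action r s) (canonical_fibre r s) (\<lambda>t. 1)"
proof -
  note rs = assms(2)
  \<comment> \<open>The gap is an s by s square without an (s-r) by (s-r) square, so this number is
    s^2 - (s-r)^2 = rs + r(s-r). The argument uses it only as a cardinality.\<close>
  define n where "n = card (gap r s)"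
  have "finite (gap r s)"
    by (rule finite_subset[of _ "{..<s} \<times> {..<s}"]) (auto simp: gap_def)
  then obtain h where h: "bij_betw h {..<n} (gap r s)"
    unfolding n_def using ex_bij_betw_nat_finite lessThan_atLeast0 by metis
  let ?V = "tangent_GH r s" and ?F = "fibre r s n h"
  note F = tangent_GH_fibre[OF rs h]
  interpret F: linear_map "class_ring :: complex ring" "module_vec TYPE(complex) n" ?V ?F
    by (rule F(1))
  have dim: "dim_GH r s = n" unfolding dim_GH_def by (rule dim_frame[OF F])
  have ext: "canonical_fibre r s = ext_power_dual n ?V" by (simp add: canonical_fibre_def dim)
  have "canonical_action r s t \<omega> = 1 \<odot>\<^bsub>canonical_fibre r s\<^esub> \<omega>"
    if t: "t \<in> torusH r s" and \<omega>: "\<omega> \<in> carrier (canonical_fibre r s)" for t \<omega>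
  proof -
    let ?L = "Ad_tangent r s (inv\<^bsub>grpG r s\<^esub> t)"
    let ?d = "\<lambda>w. vec n (\<lambda>k. weight t (h k) * w $ k)"
    have L: "?L (?F w) = ?F (?d w)" if "w \<in> carrier_vec n" for w
      by (rule Ad_tangent_fibre[OF rs h t that])
    have V: "carrier ?V = ?F ` carrier_vec n" using F(2) by (simp add: bij_betw_def)
    have F_add: "?F w \<oplus>\<^bsub>?V\<^esub> ?F w' = ?F (w + w')" if "w \<in> carrier_vec n" "w' \<in> carrier_vec n" for w w'
      using F.T_add[of w w'] that by (simp add: module_vec_simps)
    have F_smult: "a \<odot>\<^bsub>?V\<^esub> ?F w = ?F (a \<cdot>\<^sub>v w)" if "w \<in> carrier_vec n" for a w
      using F.T_smult[of a w] that by (simp add: module_vec_simps)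
    have d_add: "?d (w + w') = ?d w + ?d w'" if "w \<in> carrier_vec n" "w' \<in> carrier_vec n" for w w'
      using that by (auto simp: algebra_simps)
    have d_smult: "?d (a \<cdot>\<^sub>v w) = a \<cdot>\<^sub>v ?d w" if "w \<in> carrier_vec n" for a w
      using that by (auto simp: algebra_simps)
    have "\<omega> (\<lambda>i\<in>{..<n}. ?L (v i)) = (\<Prod>k<n. weight t (h k)) * \<omega> v" if "v \<in> tuples n ?V" for v
    proof (rule top_form_diagonal[OF F _ _ _ _ _ _ that])
      show "multilinear n ?V \<omega>" "alternating n ?V \<omega>"
        using \<omega> by (simp_all add: ext ext_power_dual_simps)
      show "?L x \<in> carrier ?V" if "x \<in> carrier ?V" for x
        using that by (auto simp: V L)
      show "?L (x \<oplus>\<^bsub>?V\<^esub> y) = ?L x \<oplus>\<^bsub>?V\<^esub> ?L y" if "x \<in> carrier ?V" "y \<in> carrier ?V" for x y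
        using that by (auto simp: V L F_add d_add)
      show "?L (a \<odot>\<^bsub>?V\<^esub> x) = a \<odot>\<^bsub>?V\<^esub> ?L x" if "x \<in> carrier ?V" for a x
        using that by (auto simp: V L F_smult d_smult)
      show "?L (?F (unit_vec n k)) = weight t (h k) \<odot>\<^bsub>?V\<^esub> ?F (unit_vec n k)" if "k < n" for k
      proof -
        have "?d (unit_vec n k) = weight t (h k) \<cdot>\<^sub>v unit_vec n k" using that by auto
        then show ?thesis by (simp add: L F_smult)
      qed
    qed
    \<comment> \<open>Reindexing along \<open>h\<close> turns this into the product over the
      gap.\<close>
    moreover have "(\<Prod>k<n. weight t (h k)) = 1"
      using prod.reindex_bij_betw[OF h, of "weight t"] prod_weight[of t r s] t
      by (simp add: torusH_def)
    ultimately show ?thesis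
      by (auto simp: canonical_action_def dim ext ext_power_dual_simps)
  qed
  then have "acts_by_character (torusH r s) (canonical_action r s) (canonical_fibre r s) (\<lambda>t. 1)"
    by (simp add: acts_by_character_def)
  then show ?thesis using dim_ext_power_dual_top[OF F] by (simp add: ext)
qed

end
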